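(* For every natural number $n\ge1$, the Dickson polynomial of the first kind $D_n(x,\alpha)$ satisfies, as an identity of polynomials in $x$ and $\alpha$ (with rational coefficients), $$D_n(x,\alpha)=\frac{x^{\delta(n)}\;\Omega_0(\lfloor n/2\rfloor\,|\,\alpha,\,2\alpha-x^2\,|\,n)}{(n-1)(n-2)\cdots(n-\lfloor n/2\rfloor)} .$$
   Context: For a natural number $m$, $\delta(m)\in\{0,1\}$ denotes $m\bmod 2$. Empty products equal $1$. For $n\ge1$ the Dickson polynomial of the first kind is $$D_n(x,\alpha)=\sum_{i=0}^{\lfloor n/2\rfloor}\frac{n}{n-i}\binom{n-i}{i}(-\alpha)^i x^{n-2i}.$$ The Quanta Prime Sequence $\Omega_r(k|\zeta,\xi|n)$ associated with $n$ and a point $(\zeta,\xi)\ne(0,0)$ is defined for integers $r,k\ge0$ with $r+k\le\lfloor n/2\rfloor$ by $\Omega_r(0|\zeta,\xi|n)=1$ for all $r$, and for $k\ge1$ $$\Omega_r(k|\zeta,\xi|n)=(2\zeta-\xi)(n-r-k)\,\Omega_r(k-1|\zeta,\xi|n)-2\zeta\,(n-2r-\delta(n-1))\,\Omega_{r+1}(k-1|\zeta,\xi|n).$$ Here it is applied with $(\zeta,\xi)=(\alpha,2\alpha-x^2)$, giving a polynomial in $x,\alpha$. *)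

theory Defs
  imports "HOL-Computational_Algebra.Polynomial"
begin

text \<open>
  The ring of polynomials in \<open>x\<close> and \<open>\<alpha>\<close> with rational coefficients is the type
  \<^typ>\<open>rat poly poly\<close>: the outer variable is \<open>x\<close>, the inner one is \<open>\<alpha>\<close>.
\<close>

definition const2 :: "rat \<Rightarrow> rat poly poly" where
  "const2 c = [:[:c:]:]"

definition var_x :: "rat poly poly" where
  "var_x = [:0, 1:]"

definition var_alpha :: "rat poly poly" where
  "var_alpha = [:[:0, 1:]:]"

definition delta :: "nat \<Rightarrow> nat" where
  "delta m = m mod 2"

definition dickson :: "nat \<Rightarrow> rat poly poly" where
  "dickson n =
     (\<Sum>i = 0..n div 2.
        const2 (of_nat n / of_nat (n - i) * of_nat ((n - i) choose i))
        * (- var_alpha) ^ i * var_x ^ (n - 2 * i))"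

text \<open>
  \<open>Omega n \<zeta> \<xi> r k\<close> is \<open>\<Omega>\<^sub>r(k | \<zeta>, \<xi> | n)\<close>. The sequence is only meant for
  \<open>r + k \<le> n div 2\<close>; the recursion makes sense for all \<open>r\<close> and \<open>k\<close>, and unfolding it from
  an index pair in that range never leaves the range, so the values there are the intended ones.
  All subtractions below are in the ring, except \<open>n - 1\<close>, where \<open>n \<ge> 1\<close>.
\<close>

primrec Omega :: "nat \<Rightarrow> 'a::comm_ring_1 \<Rightarrow> 'a \<Rightarrow> nat \<Rightarrow> nat \<Rightarrow> 'a" where
  "Omega n \<zeta> \<xi> r 0 = 1"
| "Omega n \<zeta> \<xi> r (Suc k) =
     (2 * \<zeta> - \<xi>) * (of_nat n - of_nat r - of_nat (Suc k)) * Omega n \<zeta> \<xi> r k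
     - 2 * \<zeta> * (of_nat n - 2 * of_nat r - of_nat (delta (n - 1))) * Omega n \<zeta> \<xi> (Suc r) k"

end

theory Submission
  imports Defs
begin

text \<open>
  Unfold the recursion into lattice paths. A step with the factor \<open>2\<zeta> - \<xi>\<close> has a weight that
  depends only on \<open>r + k\<close>, which such a step lowers by one and the other step preserves; a step
  with the factor \<open>-2\<zeta>\<close> has a weight that depends only on \<open>r\<close>, which only such a step changes.
  Hence all paths with \<open>i\<close> steps of the second kind have the same weight, and
  \<open>\<Omega>\<^sub>r(k)\<close> is a binomial sum of explicit products. At \<open>r = 0\<close>, \<open>k = \<lfloor>n/2\<rfloor>\<close> the products become
  factorials because \<open>2(\<lfloor>n/2\<rfloor> - j)(n - \<delta>(n-1) - 2j) = (n - 2j)(n - 2j - 1)\<close>.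
\<close>

text \<open>Pascal's rule; the term of index \<open>Suc k\<close> vanishes in the first sum. The two
  sums on the right will match the two summands of the recursion for \<open>Omega\<close>.\<close>

lemma sum_binomial_Suc:
  fixes f :: "nat \<Rightarrow> 'a::comm_semiring_1"
  shows "(\<Sum>i\<le>Suc k. of_nat (Suc k choose i) * f i) =
    (\<Sum>i\<le>k. of_nat (k choose i) * f i) + (\<Sum>i\<le>k. of_nat (k choose i) * f (Suc i))"
proof -
  have "(\<Sum>i\<le>Suc k. of_nat (Suc k choose i) * f i) =
      (f 0 + (\<Sum>i\<le>k. of_nat (k choose Suc i) * f (Suc i))) + (\<Sum>i\<le>k. of_nat (k choose i) * f (Suc i))"
    by (subst sum.atMost_Suc_shift) (simp add: algebra_simps sum.distrib)
  also have "f 0 + (\<Sum>i\<le>k. of_nat (k choose Suc i) * f (Suc i)) =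
      (\<Sum>i\<le>Suc k. of_nat (k choose i) * f i)"
    by (subst sum.atMost_Suc_shift) simp
  also have "\<dots> = (\<Sum>i\<le>k. of_nat (k choose i) * f i)"
    by (simp add: binomial_eq_0)
  finally show ?thesis .
qed

lemma Omega_closed_form:
  fixes \<zeta> \<xi> :: "'a::comm_ring_1"
  shows "Omega n \<zeta> \<xi> r k =
    (\<Sum>i\<le>k. of_nat (k choose i) *
      (pochhammer (of_nat n - of_nat r - of_nat k) (k - i) *
       (\<Prod>j<i. of_nat n - of_nat (delta (n - 1)) - 2 * of_nat r - 2 * of_nat j) *
       (2 * \<zeta> - \<xi>) ^ (k - i) * (- 2 * \<zeta>) ^ i))"
proof (induction k arbitrary: r)
  case 0
  then show ?case by simp
next
  case (Suc k)
  let ?A = "of_nat n - of_nat (delta (n - 1)) :: 'a"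
  let ?T = "\<lambda>i. pochhammer (of_nat n - of_nat r - of_nat (Suc k)) (Suc k - i) *
       (\<Prod>j<i. ?A - 2 * of_nat r - 2 * of_nat j) *
       (2 * \<zeta> - \<xi>) ^ (Suc k - i) * (- 2 * \<zeta>) ^ i"
  \<comment> \<open>A step of the first kind supplies the lowest factor of the Pochhammer symbol:
    its base drops from n - r - k to n - r - (k + 1) and its length grows by one.\<close>
  have 1: "(2 * \<zeta> - \<xi>) * (of_nat n - of_nat r - of_nat (Suc k)) * Omega n \<zeta> \<xi> r k =
      (\<Sum>i\<le>k. of_nat (k choose i) * ?T i)"
    unfolding Suc.IH sum_distrib_left
  proof (rule sum.cong[OF refl], goal_cases)
    case (1 i)
    have "pochhammer (of_nat n - of_nat r - of_nat (Suc k)) (Suc k - i) =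
        (of_nat n - of_nat r - of_nat (Suc k)) *
        pochhammer (of_nat n - of_nat r - of_nat k :: 'a) (k - i)"
      using 1 by (simp add: Suc_diff_le pochhammer_rec algebra_simps)
    with 1 show ?case
      by (simp add: Suc_diff_le mult_ac)
  qed
  \<comment> \<open>A step of the second kind leaves the Pochhammer base unchanged, since r + k is
    preserved; its weight becomes the factor j = 0 of the product and shifts the others by
    one.\<close>
  have 2: "- 2 * \<zeta> * (of_nat n - 2 * of_nat r - of_nat (delta (n - 1))) * Omega n \<zeta> \<xi> (Suc r) k =
      (\<Sum>i\<le>k. of_nat (k choose i) * ?T (Suc i))"
    unfolding Suc.IH sum_distrib_left
  proof (rule sum.cong[OF refl], goal_cases)
    case (1 i)
    have p: "(\<Prod>j<Suc i. ?A - 2 * of_nat r - 2 * of_nat j) = (?A - 2 * of_nat r) *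
        (\<Prod>j<i. ?A - 2 * of_nat (Suc r) - 2 * of_nat j)"
      by (subst prod.lessThan_Suc_shift) (simp add: algebra_simps)
    have q: "of_nat n - of_nat r - of_nat (Suc k) = (of_nat n - of_nat (Suc r) - of_nat k :: 'a)"
      "of_nat n - 2 * of_nat r - of_nat (delta (n - 1)) = ?A - 2 * of_nat r"
      by (simp_all add: algebra_simps)
    show ?case
      unfolding p q diff_Suc_Suc power_Suc by (simp only: mult_ac)
  qed
  have "Omega n \<zeta> \<xi> r (Suc k) = (\<Sum>i\<le>k. of_nat (k choose i) * ?T i) +
      (\<Sum>i\<le>k. of_nat (k choose i) * ?T (Suc i))"
    unfolding 1[symmetric] 2[symmetric] by simp
  then show ?case
    by (simp only: sum_binomial_Suc)
qed

lemma prod_diff_conv_pochhammer: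
  fixes z :: "'a::comm_ring_1"
  shows "(\<Prod>j = 1..m. z - of_nat j) = pochhammer (z - of_nat m) m"
proof (induction m)
  case (Suc m)
  then show ?case
    by (simp add: pochhammer_rec mult.commute algebra_simps)
qed simp

lemma pochhammer_mult_fact:
  "pochhammer (1 + of_nat a) b * fact a = (fact (a + b) :: 'a::{semiring_char_0,comm_semiring_1})"
  by (simp add: pochhammer_fact pochhammer_product' mult.commute)

text \<open>The factors of n! are peeled off from the top, two at a time.\<close>

lemma prod_pairs_mult_fact:
  assumes "2 * i \<le> n"
  shows "(\<Prod>j<i. (of_nat n - 2 * of_nat j) * (of_nat n - 2 * of_nat j - 1)) * fact (n - 2 * i)
    = (fact n :: 'a::field_char_0)"
  using assms
proof (induction i)
  case (Suc i)
  define a where "a = n - 2 * Suc i"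
  have n: "n = Suc (Suc (a + 2 * i))" and a: "n - 2 * i = Suc (Suc a)"
    using Suc.prems by (simp_all add: a_def)
  have "fact (n - 2 * i) = (of_nat n - 2 * of_nat i) * (of_nat n - 2 * of_nat i - 1) * (fact a :: 'a)"
    unfolding a by (simp add: n algebra_simps)
  with Suc show ?case
    by (simp add: a_def mult_ac)
qed simp

lemma binomial_mult_fact_prod:
  "of_nat (m choose i) * fact i = (\<Prod>j<i. of_nat m - of_nat j :: 'a::field_char_0)"
  by (simp add: binomial_gbinomial gbinomial_prod_rev atLeast0LessThan)

lemma half_binomial_mult_prod:
  assumes "n \<ge> 1" "i \<le> n div 2"
  shows "of_nat (n div 2 choose i) * 2 ^ i *
      (\<Prod>j<i. of_nat n - of_nat (delta (n - 1)) - 2 * of_nat j) * fact i * fact (n - 2 * i)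
    = (fact n :: 'a::field_char_0)"
proof -
  \<comment> \<open>On the left, the first factor is n - 2j for even n and n - 2j - 1 for odd n; the
    second factor is the other one of the pair. For even n this needs n > 0, because
    \<open>n - 1\<close> truncates at 0.\<close>
  have *: "2 * (of_nat (n div 2) - of_nat j) * (of_nat n - of_nat (delta (n - 1)) - 2 * of_nat j)
      = (of_nat n - 2 * of_nat j) * (of_nat n - 2 * of_nat j - 1 :: 'a)" for j
  proof (cases "even n")
    case True
    then obtain m where "n = 2 * m" by blast
    moreover from this assms have "delta (n - 1) = 1"
      by (cases m) (auto simp: delta_def)
    ultimately show ?thesis by (simp add: algebra_simps)
  next
    case False
    then obtain m where "n = 2 * m + 1" by (blast elim: oddE)
    then show ?thesis by (simp add: delta_def algebra_simps)
  qed
  have "of_nat (n div 2 choose i) * 2 ^ i *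
      (\<Prod>j<i. of_nat n - of_nat (delta (n - 1)) - 2 * of_nat j) * fact i =
      2 ^ i * (of_nat (n div 2 choose i) * fact i) *
      (\<Prod>j<i. of_nat n - of_nat (delta (n - 1)) - 2 * of_nat j :: 'a)"
    by (simp only: mult_ac)
  also have "\<dots> = (\<Prod>j<i. 2 * (of_nat (n div 2) - of_nat j) *
      (of_nat n - of_nat (delta (n - 1)) - 2 * of_nat j))"
    unfolding binomial_mult_fact_prod prod.distrib by simp
  also have "\<dots> = (\<Prod>j<i. (of_nat n - 2 * of_nat j) * (of_nat n - 2 * of_nat j - 1))"
    by (simp only: *)
  finally show ?thesis
    using assms(2) by (simp only: prod_pairs_mult_fact)
qed

lemma dickson_coeff:
  assumes "n \<ge> 1" "i \<le> n div 2"
  shows "of_nat n / of_nat (n - i) * of_nat ((n - i) choose i) =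
    1 / (\<Prod>j = 1..n div 2. of_nat n - of_nat j) *
    (of_nat (n div 2 choose i) * pochhammer (of_nat n - of_nat (n div 2)) (n div 2 - i) *
      (\<Prod>j<i. of_nat n - of_nat (delta (n - 1)) - 2 * of_nat j) * 2 ^ i :: 'a::field_char_0)"
proof -
  define m where "m = n div 2"
  \<comment> \<open>Both Pochhammer symbols have base n - m = 1 + a, so multiplying by a! completes
    each of them to a factorial.\<close>
  define a where "a = n - m - 1"
  define P where "P = (\<Prod>j<i. of_nat n - of_nat (delta (n - 1)) - 2 * of_nat j :: 'a)"
  have m: "2 * m \<le> n" "m < n" "i \<le> m"
    using assms by (auto simp: m_def)
  have nm: "of_nat n - of_nat m = (1 + of_nat a :: 'a)"
    using m by (simp add: a_def of_nat_diff)
  have p1: "pochhammer (1 + of_nat a) m * fact a = (fact (n - 1) :: 'a)"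
  proof -
    have "a + m = n - 1" using m by (simp add: a_def)
    then show ?thesis by (simp only: pochhammer_mult_fact)
  qed
  have p2: "pochhammer (1 + of_nat a) (m - i) * fact a = (fact (n - i - 1) :: 'a)"
  proof -
    have "a + (m - i) = n - i - 1" using m by (simp add: a_def)
    then show ?thesis by (simp only: pochhammer_mult_fact)
  qed
  have c: "of_nat ((n - i) choose i) * fact i * fact (n - 2 * i) = (fact (n - i) :: 'a)"
  proof -
    have "n - i - i = n - 2 * i" "i \<le> n - i" using m by simp_all
    then have "((n - i) choose i) * fact i * fact (n - 2 * i) = (fact (n - i) :: nat)"
      using binomial_fact_lemma[of i "n - i"] by (simp add: mult_ac)
    then show ?thesis
      by (metis of_nat_fact of_nat_mult)
  qed
  have h: "of_nat (m choose i) * 2 ^ i * P * fact i * fact (n - 2 * i) = (fact n :: 'a)"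
    using half_binomial_mult_prod[OF assms] by (simp add: P_def m_def)
  have f1: "fact n = of_nat n * (fact (n - 1) :: 'a)"
    using assms by (simp add: fact_reduce)
  have f2: "fact (n - i) = of_nat (n - i) * (fact (n - i - 1) :: 'a)"
    using m by (simp add: fact_reduce)
  have nz: "pochhammer (1 + of_nat a) m \<noteq> (0 :: 'a)" "of_nat (n - i) \<noteq> (0 :: 'a)"
    using p1 m by (auto simp del: of_nat_diff)
  \<comment> \<open>After multiplication by \<open>?K\<close> both sides consist of factorials, and
    the claim reduces to n (n-i)! (n-1)! = (n-i) n! (n-i-1)!.\<close>
  let ?K = "fact i * fact (n - 2 * i) * fact a :: 'a"
  have "?K * (of_nat n * of_nat ((n - i) choose i) * pochhammer (1 + of_nat a) m) =
      of_nat n * (of_nat ((n - i) choose i) * fact i * fact (n - 2 * i)) *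
      (pochhammer (1 + of_nat a) m * fact a)"
    by (simp only: mult_ac)
  also have "\<dots> = of_nat (n - i) * fact n * fact (n - i - 1)"
    unfolding c p1 f1 f2 by (simp only: mult_ac)
  also have "\<dots> = of_nat (n - i) * (of_nat (m choose i) * 2 ^ i * P * fact i * fact (n - 2 * i)) *
      (pochhammer (1 + of_nat a) (m - i) * fact a)"
    unfolding h p2 ..
  also have "\<dots> = ?K * (of_nat (n - i) *
      (of_nat (m choose i) * pochhammer (1 + of_nat a) (m - i) * P * 2 ^ i))"
    by (simp only: mult_ac)
  finally have "of_nat n * of_nat ((n - i) choose i) * pochhammer (1 + of_nat a) m =
      of_nat (n - i) * (of_nat (m choose i) * pochhammer (1 + of_nat a) (m - i) * P * 2 ^ i)"
    by simp
  then have "of_nat n / of_nat (n - i) * of_nat ((n - i) choose i) =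
      1 / pochhammer (1 + of_nat a) m *
      (of_nat (m choose i) * pochhammer (1 + of_nat a) (m - i) * P * 2 ^ i)"
    using nz by (simp add: field_simps del: of_nat_diff)
  then show ?thesis
    unfolding prod_diff_conv_pochhammer m_def[symmetric] P_def[symmetric] nm .
qed

lemma const2_hom:
  "const2 1 = 1"
  "const2 (a * b) = const2 a * const2 b"
  "const2 (a + b) = const2 a + const2 b"
  "const2 (a - b) = const2 a - const2 b"
  "const2 (of_nat k) = of_nat k"
  by (simp_all add: const2_def of_nat_poly one_pCons)

lemma const2_numeral: "const2 (numeral k) = numeral k"
  using const2_hom(5)[of "numeral k"] by simp

lemma const2_prod: "const2 (prod f A) = (\<Prod>a\<in>A. const2 (f a))"
  by (induction A rule: infinite_finite_induct) (simp_all add: const2_hom)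

lemma const2_power: "const2 (a ^ k) = const2 a ^ k"
  by (induction k) (simp_all add: const2_hom)

lemma const2_pochhammer: "const2 (pochhammer a k) = pochhammer (const2 a) k"
  by (simp add: pochhammer_prod const2_prod const2_hom)

theorem theorem46:
  fixes n :: nat
  assumes "n \<ge> 1"
  shows "dickson n =
    const2 (1 / (\<Prod>j = 1..n div 2. of_nat n - of_nat j))
    * (var_x ^ delta n
       * Omega n var_alpha (2 * var_alpha - var_x ^ 2) 0 (n div 2))"
proof -
  let ?m = "n div 2"
  let ?c = "const2 (1 / (\<Prod>j = 1..?m. of_nat n - of_nat j))"
  \<comment> \<open>The chosen point turns the factor 2\<zeta> - \<xi> into x^2, so
    \<open>Omega\<close> contributes even powers of x only and x^\<delta>(n) corrects the
    parity.\<close>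
  have x: "2 * var_alpha - (2 * var_alpha - var_x ^ 2) = var_x ^ 2"
    by simp
  show ?thesis
    unfolding dickson_def Omega_closed_form x sum_distrib_left atLeast0AtMost
  proof (rule sum.cong[OF refl], goal_cases)
    case (1 i)
    let ?p = "pochhammer (of_nat n - of_nat 0 - of_nat ?m) (?m - i) :: rat poly poly"
    let ?q = "\<Prod>j<i. of_nat n - of_nat (delta (n - 1)) - 2 * of_nat 0 - 2 * of_nat j :: rat poly poly"
    have "n - 2 * i = delta n + 2 * (?m - i)"
      using 1 by (simp add: delta_def minus_mult_div_eq_mod[symmetric] diff_mult_distrib2)
    then have xp: "var_x ^ (n - 2 * i) = var_x ^ delta n * (var_x ^ 2) ^ (?m - i)"
      by (simp add: power_add power_mult)
    \<comment> \<open>The sign stays with \<alpha> as in the Dickson polynomial; 2^i joins the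
      rational coefficient.\<close>
    have ap: "(- 2 * var_alpha) ^ i = 2 ^ i * (- var_alpha) ^ i"
      by (simp flip: power_mult_distrib)
    \<comment> \<open>The coefficient identity involves division, so it is used over the field of
      rationals and then carried into the polynomial ring by the homomorphism
      \<open>const2\<close>.\<close>
    have co: "const2 (of_nat n / of_nat (n - i) * of_nat ((n - i) choose i)) =
        ?c * (of_nat (?m choose i) * ?p * ?q * 2 ^ i)"
      using 1 assms
      by (simp only: atMost_iff dickson_coeff)
        (simp only: const2_hom const2_prod const2_power const2_pochhammer const2_numeral
          of_nat_0 mult_zero_right diff_zero)
    show ?case
      unfolding xp ap co by (simp only: mult_ac)
  qed
qed

end
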